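(* Let $n\ge 1$. The rule $\mathrm{Cut}$ is eliminable in the non-wellfounded calculus $\mathcal{G}^\infty\mathsf{wGL}_n$, i.e. every sequent provable in $\mathcal{G}^\infty\mathsf{wGL}_n+\mathrm{Cut}$ is provable in $\mathcal{G}^\infty\mathsf{wGL}_n$. As a corollary, $\mathrm{Cut}$ is eliminable in the wellfounded calculus $\mathcal{G}\mathsf{wGL}_n$, i.e. every sequent provable in $\mathcal{G}\mathsf{wGL}_n+\mathrm{Cut}$ is provable in $\mathcal{G}\mathsf{wGL}_n$.
   Context: Formulas are built from a countably infinite set $\mathrm{Var}$ of propositional variables by $\phi::=p\mid\bot\mid\phi\to\phi\mid\Box\phi$; $\Box^0\phi:=\phi$, $\Box^{m+1}\phi:=\Box\Box^m\phi$. A sequent $\Gamma\Rightarrow\Delta$ is an ordered pair of finite multisets of formulas. For a finite multiset $\Sigma$, $\Box^n\Sigma$ is the multiset obtained by prefixing each element with $\Box^n$, and $\boxdot^n\Sigma$ denotes the multiset $\Box^n\Sigma,\Sigma$. Rules ($p\in\mathrm{Var}$, all multisets arbitrary and finite): (ax) conclude $p,\Gamma\Rightarrow p,\Delta$ from no premises; ($\bot$L) conclude $\bot,\Gamma\Rightarrow\Delta$ from no premises; ($\bot$R) from $\Gamma\Rightarrow\Delta$ infer $\Gamma\Rightarrow\bot,\Delta$; ($\to$L) from $\Gamma\Rightarrow\phi,\Delta$ and $\psi,\Gamma\Rightarrow\Delta$ infer $\phi\to\psi,\Gamma\Rightarrow\Delta$; ($\to$R) from $\phi,\Gamma\Rightarrow\psi,\Delta$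 infer $\Gamma\Rightarrow\phi\to\psi,\Delta$; ($\Box^{\mathsf{wGL}_n}$) from $\boxdot^n\Sigma,\Box^n\phi\Rightarrow\phi$ infer $\Box\Sigma,\Gamma\Rightarrow\Box\phi,\Delta$; ($\Box^{\mathsf{wK4}_n}$) from $\boxdot^n\Sigma\Rightarrow\phi$ infer $\Box\Sigma,\Gamma\Rightarrow\Box\phi,\Delta$; ($\mathrm{Cut}$) from $\Gamma\Rightarrow\Delta,\chi$ and $\chi,\Gamma\Rightarrow\Delta$ infer $\Gamma\Rightarrow\Delta$. $\mathcal{G}\mathsf{wGL}_n$ has the rules (ax), ($\bot$L), ($\bot$R), ($\to$L), ($\to$R), ($\Box^{\mathsf{wGL}_n}$); its proofs (with or without $\mathrm{Cut}$) are finite trees locally correct with respect to the rules. $\mathcal{G}^\infty\mathsf{wGL}_n$ has the rules (ax), ($\bot$L), ($\bot$R), ($\to$L), ($\to$R), ($\Box^{\mathsf{wK4}_n}$); its proofs (with or without $\mathrm{Cut}$) are possibly infinite, finitely branching trees, locally correct with respect to the rules, such that every infinite branch passes infinitely often through the premise of an instance of ($\Box^{\mathsf{wK4}_n}$). *)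

theory Defs
  imports "HOL-Library.Multiset" "HOL-Library.Infinite_Set"
begin

datatype fm = Var nat | Bot | Imp fm fm | Box fm

type_synonym sequent = "fm multiset \<times> fm multiset"

abbreviation box_pow :: "nat \<Rightarrow> fm \<Rightarrow> fm" where
  "box_pow m \<phi> \<equiv> (Box ^^ m) \<phi>"

definition box_pow_mset :: "nat \<Rightarrow> fm multiset \<Rightarrow> fm multiset" where
  "box_pow_mset m \<Sigma> = image_mset (box_pow m) \<Sigma>"

definition boxdot_mset :: "nat \<Rightarrow> fm multiset \<Rightarrow> fm multiset" where
  "boxdot_mset m \<Sigma> = box_pow_mset m \<Sigma> + \<Sigma>"

datatype rule_name = Ax | BotL | BotR | ImpL | ImpR | BoxGL | BoxK4 | Cut

inductive rule_inst :: "nat \<Rightarrow> rule_name \<Rightarrow> sequent list \<Rightarrow> sequent \<Rightarrow> bool" for n :: nat where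
  inst_Ax: "rule_inst n Ax [] (add_mset (Var p) \<Gamma>, add_mset (Var p) \<Delta>)"
| inst_BotL: "rule_inst n BotL [] (add_mset Bot \<Gamma>, \<Delta>)"
| inst_BotR: "rule_inst n BotR [(\<Gamma>, \<Delta>)] (\<Gamma>, add_mset Bot \<Delta>)"
| inst_ImpL: "rule_inst n ImpL [(\<Gamma>, add_mset \<phi> \<Delta>), (add_mset \<psi> \<Gamma>, \<Delta>)]
    (add_mset (Imp \<phi> \<psi>) \<Gamma>, \<Delta>)"
| inst_ImpR: "rule_inst n ImpR [(add_mset \<phi> \<Gamma>, add_mset \<psi> \<Delta>)] (\<Gamma>, add_mset (Imp \<phi> \<psi>) \<Delta>)"
| inst_BoxGL: "rule_inst n BoxGL [(add_mset (box_pow n \<phi>) (boxdot_mset n \<Sigma>), {#\<phi>#})]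
    (image_mset Box \<Sigma> + \<Gamma>, add_mset (Box \<phi>) \<Delta>)"
| inst_BoxK4: "rule_inst n BoxK4 [(boxdot_mset n \<Sigma>, {#\<phi>#})]
    (image_mset Box \<Sigma> + \<Gamma>, add_mset (Box \<phi>) \<Delta>)"
| inst_Cut: "rule_inst n Cut [(\<Gamma>, add_mset \<chi> \<Delta>), (add_mset \<chi> \<Gamma>, \<Delta>)] (\<Gamma>, \<Delta>)"

text \<open>The calculi, as sets of rules; the parameter \<open>n\<close> of the modal rules is supplied
  separately to \<open>rule_inst\<close>.\<close>

definition GwGL :: "rule_name set" where
  "GwGL = {Ax, BotL, BotR, ImpL, ImpR, BoxGL}"

definition GwGL_inf :: "rule_name set" where
  "GwGL_inf = {Ax, BotL, BotR, ImpL, ImpR, BoxK4}"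

text \<open>Possibly infinite, finitely branching trees; each node records its sequent and the rule
  applied there.\<close>

codatatype ptree = Node (concl: sequent) (last_rule: rule_name) (subtrees: "ptree list")

coinductive locally_correct :: "nat \<Rightarrow> rule_name set \<Rightarrow> ptree \<Rightarrow> bool"
  for n :: nat and R :: "rule_name set" where
  "\<lbrakk>r \<in> R; rule_inst n r (map concl ts) S; \<forall>t \<in> set ts. locally_correct n R t\<rbrakk>
    \<Longrightarrow> locally_correct n R (Node S r ts)"

text \<open>As every node has finitely many subtrees, the well-founded trees are exactly the finite ones.\<close>

inductive finite_tree :: "ptree \<Rightarrow> bool" where
  "(\<forall>t \<in> set ts. finite_tree t) \<Longrightarrow> finite_tree (Node S r ts)"

text \<open>A branch is given by the sequence of subtrees rooted at its nodes.\<close>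

definition infinite_branch :: "ptree \<Rightarrow> (nat \<Rightarrow> ptree) \<Rightarrow> bool" where
  "infinite_branch t b \<longleftrightarrow> b 0 = t \<and> (\<forall>i. b (Suc i) \<in> set (subtrees (b i)))"

text \<open>If \<open>BoxK4\<close> is applied at \<open>b i\<close>, the branch continues through its only premise
  \<open>b (Suc i)\<close>.\<close>

definition progressing :: "ptree \<Rightarrow> bool" where
  "progressing t \<longleftrightarrow> (\<forall>b. infinite_branch t b \<longrightarrow> (\<exists>\<^sub>\<infinity>i. last_rule (b i) = BoxK4))"

definition provable :: "nat \<Rightarrow> rule_name set \<Rightarrow> sequent \<Rightarrow> bool" where
  "provable n R S \<longleftrightarrow> (\<exists>t. concl t = S \<and> locally_correct n R t \<and> finite_tree t)"

definition provable_inf :: "nat \<Rightarrow> rule_name set \<Rightarrow> sequent \<Rightarrow> bool" where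
  "provable_inf n R S \<longleftrightarrow> (\<exists>t. concl t = S \<and> locally_correct n R t \<and> progressing t)"

end

theory Submission
  imports Defs
begin

text \<open>
  The proof is semantic: every calculus with cut is sound for a class of finite models, and both
  cut-free calculi are complete for it.

  A model is a finite tree in which \<open>Box \<phi>\<close> holds at a node iff \<open>\<phi>\<close> holds at all of its
  descendants at distance \<open>1 + k * n\<close>. Distances of this form are closed under sums of \<open>n + 1\<close>
  summands, which gives the transitivity \<open>Box \<phi> \<longrightarrow> box_pow (n + 1) \<phi>\<close>; finiteness gives the
  Loeb-style induction built into \<open>BoxGL\<close>. The decisive feature of these trees is that the truth
  of \<open>Box \<phi>\<close> at the root amounts to the truth of \<open>\<phi>\<close> and \<open>box_pow n \<phi>\<close> at every child
  (\<open>sat_Box_boxdot\<close>), which is what the modal rules say.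

  Soundness: a model refuting the conclusion of a rule yields a model refuting a premise; the model
  is unchanged for a propositional rule or cut and strictly shrinks for \<open>BoxK4\<close>
  (\<open>refuted_premise\<close>). Along an infinite branch of a progressing proof the size would therefore
  decrease infinitely often.

  Completeness rests on \<open>valid_step\<close>: every valid sequent is the conclusion of a cut-free rule
  with valid premises. For a saturated sequent this holds because otherwise countermodels of all
  the possible modal premises could be joined under a new root (\<open>glue_countermodels\<close>). Iterating
  \<open>valid_step\<close> corecursively gives a possibly infinite cut-free proof, which is progressing since
  propositional rules remove a connective. For the wellfounded calculus the same steps are carried
  out with \<open>BoxGL\<close> in place of \<open>BoxK4\<close>, and the search is shown to terminate. There is no
  subformula property, as the formulas \<open>box_pow m \<phi>\<close> grow on the left, but the boxed formulas
  appearing on the right stay in a finite set. Once \<open>Box \<phi>\<close> has been principal on the right, the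
  formula \<open>box_pow n \<phi>\<close> put on the left by \<open>BoxGL\<close> brings \<open>Box \<phi>\<close> back to the left after
  every \<open>n\<close> modal steps. Hence \<open>Box \<phi>\<close> cannot again be principal at the same residue modulo
  \<open>n\<close> without the sequent being closed by identity, and the number of pairs of such a \<open>\<phi>\<close> and a
  residue bounds the number of modal steps (\<open>locked_modal\<close>).
\<close>

section \<open>Finite tree models\<close>

datatype model = Point (true_vars: "nat set") (children: "model list")

primrec at_depth :: "nat \<Rightarrow> model \<Rightarrow> model set" where
  "at_depth 0 M = {M}"
| "at_depth (Suc d) M = (\<Union>K\<in>set (children M). at_depth d K)"

primrec sat :: "nat \<Rightarrow> model \<Rightarrow> fm \<Rightarrow> bool" where
  "sat n M (Var p) \<longleftrightarrow> p \<in> true_vars M"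
| "sat n M Bot \<longleftrightarrow> False"
| "sat n M (Imp \<phi> \<psi>) \<longleftrightarrow> (sat n M \<phi> \<longrightarrow> sat n M \<psi>)"
| "sat n M (Box \<phi>) \<longleftrightarrow> (\<forall>k. \<forall>K\<in>at_depth (Suc (k * n)) M. sat n K \<phi>)"

definition refutes :: "nat \<Rightarrow> model \<Rightarrow> sequent \<Rightarrow> bool" where
  "refutes n M S \<longleftrightarrow> (\<forall>\<phi>\<in>#fst S. sat n M \<phi>) \<and> (\<forall>\<phi>\<in>#snd S. \<not> sat n M \<phi>)"

definition valid :: "nat \<Rightarrow> sequent \<Rightarrow> bool" where
  "valid n S \<longleftrightarrow> (\<forall>M. \<not> refutes n M S)"

lemma at_depth_add: "at_depth (a + b) M = (\<Union>K\<in>at_depth a M. at_depth b K)"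
  by (induction a arbitrary: M) auto

lemma at_depth_trans: "K \<in> at_depth a M \<Longrightarrow> L \<in> at_depth b K \<Longrightarrow> L \<in> at_depth (a + b) M"
  by (auto simp: at_depth_add)

lemma size_child: "K \<in> set (children M) \<Longrightarrow> size K < size M"
  by (cases M) (auto dest!: size_list_estimation'[where f = size, OF _ order_refl] simp: less_Suc_eq_le)

lemma size_at_depth: "K \<in> at_depth d M \<Longrightarrow> d > 0 \<Longrightarrow> size K < size M"
proof (induction d arbitrary: M)
  case (Suc d)
  then obtain L where "L \<in> set (children M)" "K \<in> at_depth d L"
    by auto
  with Suc.IH[of L] size_child[of L M] show ?case
    by (cases d) auto
qed simp

lemma sat_box_pow:
  "sat n M (box_pow (Suc m) \<phi>) \<longleftrightarrow> (\<forall>k. \<forall>K\<in>at_depth (Suc m + k * n) M. sat n K \<phi>)"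
proof (induction m arbitrary: M)
  case (Suc m)
  have "sat n M (box_pow (Suc (Suc m)) \<phi>) \<longleftrightarrow>
    (\<forall>k. \<forall>L\<in>at_depth (Suc (k * n)) M. \<forall>j. \<forall>K\<in>at_depth (Suc m + j * n) L. sat n K \<phi>)"
    using Suc by simp
  also have "\<dots> \<longleftrightarrow> (\<forall>k j. \<forall>K\<in>at_depth (Suc (k * n) + (Suc m + j * n)) M. sat n K \<phi>)"
    unfolding at_depth_add by blast
  also have "\<dots> \<longleftrightarrow> (\<forall>k j. \<forall>K\<in>at_depth (Suc (Suc m) + (k + j) * n) M. sat n K \<phi>)"
    by (simp add: algebra_simps del: at_depth.simps)
  also have "\<dots> \<longleftrightarrow> (\<forall>k. \<forall>K\<in>at_depth (Suc (Suc m) + k * n) M. sat n K \<phi>)"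
    by (metis add.right_neutral)
  finally show ?case .
qed simp

lemma sat_box_pow_pos:
  assumes "n \<ge> 1"
  shows "sat n M (box_pow n \<phi>) \<longleftrightarrow> (\<forall>k. \<forall>K\<in>at_depth (Suc k * n) M. sat n K \<phi>)"
  using assms sat_box_pow[of n M "n - 1" \<phi>] by simp

text \<open>A descendant at distance \<open>1 + k * n\<close> is a descendant of a child at distance \<open>k * n\<close>;
  the case \<open>k = 0\<close> accounts for \<open>\<phi>\<close> and the case \<open>k > 0\<close> for \<open>box_pow n \<phi>\<close>.\<close>

lemma sat_Box_boxdot:
  assumes n: "n \<ge> 1"
  shows "sat n M (Box \<phi>) \<longleftrightarrow> (\<forall>K\<in>set (children M). sat n K \<phi> \<and> sat n K (box_pow n \<phi>))"
    (is "_ \<longleftrightarrow> ?R")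
proof -
  have "sat n M (Box \<phi>) \<longleftrightarrow> (\<forall>K\<in>set (children M). \<forall>k. \<forall>L\<in>at_depth (k * n) K. sat n L \<phi>)"
    by auto
  also have "\<dots> \<longleftrightarrow> ?R"
    unfolding sat_box_pow_pos[OF n]
    by (metis at_depth.simps(1) mult_0 not0_implies_Suc singletonD singletonI)
  finally show ?thesis .
qed

section \<open>Soundness\<close>

lemma sat_box_pow_at_depth:
  assumes n: "n \<ge> 1" and "sat n M (Box \<phi>)" and K: "K \<in> at_depth (Suc (k * n)) M"
  shows "sat n K (box_pow n \<phi>)"
  unfolding sat_box_pow_pos[OF n]
proof (intro allI ballI)
  fix j L assume "L \<in> at_depth (Suc j * n) K"
  from at_depth_trans[OF K this] have "L \<in> at_depth (Suc ((k + Suc j) * n)) M"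
    by (simp add: algebra_simps del: at_depth.simps)
  with assms(2) show "sat n L \<phi>"
    unfolding sat.simps by blast
qed

text \<open>The step where finiteness of models enters: among the descendants that refute \<open>\<phi>\<close>, one
  with the smallest subtree has no relevant proper descendant refuting \<open>\<phi>\<close>.\<close>

lemma least_counterexample:
  assumes n: "n \<ge> 1" and "\<not> sat n M (Box \<phi>)"
  obtains k K where "K \<in> at_depth (Suc (k * n)) M" "\<not> sat n K \<phi>" "sat n K (box_pow n \<phi>)"
proof -
  define P where "P K \<longleftrightarrow> (\<exists>k. K \<in> at_depth (Suc (k * n)) M) \<and> \<not> sat n K \<phi>" for K
  have "\<exists>K. P K"
    using assms(2) by (auto simp: P_def simp del: at_depth.simps)
  then obtain K where K: "P K" and least: "\<And>L. P L \<Longrightarrow> size K \<le> size L"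
    using ex_has_least_nat[of P _ size] by blast
  obtain k where k: "K \<in> at_depth (Suc (k * n)) M"
    using K by (auto simp: P_def)
  have "sat n L \<phi>" if L: "L \<in> at_depth (Suc j * n) K" for j L
  proof -
    have "L \<in> at_depth (Suc ((k + Suc j) * n)) M"
      using at_depth_trans[OF k L] by (simp add: algebra_simps del: at_depth.simps)
    moreover have "size L < size K"
      using size_at_depth[OF L] n by simp
    ultimately show ?thesis
      using least[of L] unfolding P_def by (meson leD)
  qed
  then have "sat n K (box_pow n \<phi>)"
    unfolding sat_box_pow_pos[OF n] by blast
  with that k K show ?thesis
    by (auto simp: P_def)
qed

text \<open>The premise of \<open>BoxGL\<close> has one more formula on the left than that of \<open>BoxK4\<close>, so the
  refutation obtained here serves both rules.\<close>

lemma refuted_premise_modal: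
  assumes n: "n \<ge> 1" and ref: "refutes n M (image_mset Box \<Sigma> + \<Gamma>, add_mset (Box \<phi>) \<Delta>)"
  obtains K where "size K < size M"
    "refutes n K (add_mset (box_pow n \<phi>) (boxdot_mset n \<Sigma>), {#\<phi>#})"
proof -
  from ref have "\<not> sat n M (Box \<phi>)"
    by (simp add: refutes_def)
  then obtain k K where K: "K \<in> at_depth (Suc (k * n)) M"
    and "\<not> sat n K \<phi>" "sat n K (box_pow n \<phi>)"
    using least_counterexample[OF n] by blast
  moreover have "sat n K \<psi> \<and> sat n K (box_pow n \<psi>)" if "\<psi> \<in># \<Sigma>" for \<psi>
  proof -
    have "Box \<psi> \<in># image_mset Box \<Sigma> + \<Gamma>"
      using that by simp
    then have "sat n M (Box \<psi>)"
      using ref unfolding refutes_def fst_conv by blast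
    with sat_box_pow_at_depth[OF n this K] K show ?thesis
      unfolding sat.simps by blast
  qed
  ultimately show ?thesis
    using that[of K] size_at_depth[OF K]
    by (auto simp: refutes_def boxdot_mset_def box_pow_mset_def)
qed

lemma refuted_premise:
  assumes n: "n \<ge> 1" and "rule_inst n r Ss S" and "refutes n M S"
  obtains S' M' where "S' \<in> set Ss" "refutes n M' S'"
    "size M' \<le> size M" "r = BoxK4 \<Longrightarrow> size M' < size M"
  using assms(2)
proof cases
  case (inst_BoxGL \<phi> \<Sigma> \<Gamma> \<Delta>)
  with assms(3) show ?thesis
    by (auto elim!: refuted_premise_modal[OF n] intro: that)
next
  case (inst_BoxK4 \<Sigma> \<phi> \<Gamma> \<Delta>)
  then obtain K where "size K < size M"
    "refutes n K (add_mset (box_pow n \<phi>) (boxdot_mset n \<Sigma>), {#\<phi>#})"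
    using assms(3) refuted_premise_modal[OF n] by metis
  with inst_BoxK4 show ?thesis
    by (intro that[of _ K]) (auto simp: refutes_def)
next
  case (inst_ImpL \<Gamma> \<phi> \<Delta> \<psi>)
  with assms(3) show ?thesis
    by (cases "sat n M \<phi>") (auto simp: refutes_def intro: that[of _ M])
next
  case (inst_Cut \<Gamma> \<chi> \<Delta>)
  with assms(3) show ?thesis
    by (cases "sat n M \<chi>") (auto simp: refutes_def intro: that[of _ M])
qed (use assms(3) in \<open>auto simp: refutes_def intro: that[of _ M]\<close>)

lemma locally_correct_rule:
  "locally_correct n R t \<Longrightarrow>
    last_rule t \<in> R \<and> rule_inst n (last_rule t) (map concl (subtrees t)) (concl t)"
  by (auto elim: locally_correct.cases)

lemma locally_correct_subtree:
  "locally_correct n R t \<Longrightarrow> u \<in> set (subtrees t) \<Longrightarrow> locally_correct n R u"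
  by (auto elim: locally_correct.cases)

lemma sound_finite:
  assumes n: "n \<ge> 1"
  shows "finite_tree t \<Longrightarrow> locally_correct n R t \<Longrightarrow> valid n (concl t)"
proof (induction rule: finite_tree.induct)
  case (1 ts S r)
  then have "valid n S'" if "S' \<in> set (map concl ts)" for S'
    using that locally_correct_subtree[OF 1(2)] by auto
  then show ?case
    using refuted_premise[OF n] locally_correct_rule[OF 1(2)] unfolding valid_def
    by (metis ptree.sel)
qed

lemma no_infinite_descent:
  fixes f :: "nat \<Rightarrow> nat"
  assumes "\<And>i. f (Suc i) \<le> f i"
  shows "\<not> (\<exists>\<^sub>\<infinity>i. f (Suc i) < f i)"
proof
  assume inf: "\<exists>\<^sub>\<infinity>i. f (Suc i) < f i"
  obtain N where "\<And>i. f N \<le> f i"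
    using ex_has_least_nat[of "\<lambda>_. True" 0 f] by auto
  moreover obtain i where "i \<ge> N" "f (Suc i) < f i"
    using inf by (auto simp: INFM_nat_le)
  moreover have "f i \<le> f N"
    using lift_Suc_antimono_le[of f N i] assms \<open>i \<ge> N\<close> by auto
  ultimately show False
    by (metis leD order_less_le_trans)
qed

text \<open>A refutation of the conclusion is pushed upwards through \<open>refuted_premise\<close>. The branch
  traced in this way passes through \<open>BoxK4\<close> infinitely often, so the sizes of the refuting models
  would descend forever.\<close>

lemma sound_progressing:
  assumes n: "n \<ge> 1" and t: "locally_correct n R t" and prog: "progressing t"
  shows "valid n (concl t)"
  unfolding valid_def
proof (intro allI notI)
  fix M assume M: "refutes n M (concl t)"
  define Inv where "Inv = (\<lambda>(u, K). locally_correct n R u \<and> refutes n K (concl u))"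
  define Step :: "ptree \<times> model \<Rightarrow> ptree \<times> model \<Rightarrow> bool"
    where "Step = (\<lambda>(u, K) (v, L). v \<in> set (subtrees u) \<and> size L \<le> size K \<and>
    (last_rule u = BoxK4 \<longrightarrow> size L < size K))"
  have "\<exists>y. Inv y \<and> Step x y" if "Inv x" for x
  proof (cases x)
    case (Pair u K)
    with that have u: "locally_correct n R u" "refutes n K (concl u)"
      by (auto simp: Inv_def)
    from refuted_premise[OF n _ u(2)] locally_correct_rule[OF u(1)]
    obtain S' L where "S' \<in> set (map concl (subtrees u))" "refutes n L S'" "size L \<le> size K"
      "last_rule u = BoxK4 \<Longrightarrow> size L < size K"
      by metis
    with Pair locally_correct_subtree[OF u(1)] show ?thesis
      by (auto simp: Inv_def Step_def)
  qed
  then obtain succ where succ: "\<And>x. Inv x \<Longrightarrow> Inv (succ x) \<and> Step x (succ x)"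
    by metis
  define f where "f i = (succ ^^ i) (t, M)" for i
  have "Inv (f i)" for i
    using t M succ by (induction i) (auto simp: f_def Inv_def)
  with succ have f: "f 0 = (t, M)" "\<And>i. Step (f i) (f (Suc i))"
    by (auto simp: f_def)
  have "infinite_branch t (fst \<circ> f)"
    using f by (simp add: infinite_branch_def Step_def case_prod_beta)
  with prog have "\<exists>\<^sub>\<infinity>i. last_rule (fst (f i)) = BoxK4"
    by (auto simp: progressing_def)
  then have "\<exists>\<^sub>\<infinity>i. size (snd (f (Suc i))) < size (snd (f i))"
    by (rule INFM_mono) (use f(2) in \<open>simp add: Step_def case_prod_beta\<close>)
  then show False
    using no_infinite_descent[of "\<lambda>i. size (snd (f i))"] f(2)
    by (simp add: Step_def case_prod_beta)
qed

section \<open>Backward analysis of valid sequents\<close>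

definition propositional :: "rule_name set" where
  "propositional = {Ax, BotL, BotR, ImpL, ImpR}"

text \<open>Only connectives outside boxes count: these are what propositional rules remove, and
  implications below a box are out of their reach.\<close>

primrec weight :: "fm \<Rightarrow> nat" where
  "weight (Var p) = 0"
| "weight Bot = 1"
| "weight (Imp \<phi> \<psi>) = Suc (weight \<phi> + weight \<psi>)"
| "weight (Box \<phi>) = 0"

definition seq_weight :: "sequent \<Rightarrow> nat" where
  "seq_weight S = (\<Sum>\<phi>\<in>#fst S. weight \<phi>) + (\<Sum>\<phi>\<in>#snd S. weight \<phi>)"

lemma propositional_weight:
  "rule_inst n r Ss S \<Longrightarrow> r \<in> propositional \<Longrightarrow> S' \<in> set Ss \<Longrightarrow> seq_weight S' < seq_weight S"
  by (erule rule_inst.cases) (auto simp: propositional_def seq_weight_def)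

lemma Box_part:
  obtains \<Sigma> \<Gamma>' where "\<Gamma> = image_mset Box \<Sigma> + \<Gamma>'" "\<And>\<psi>. Box \<psi> \<in># \<Gamma> \<longleftrightarrow> \<psi> \<in># \<Sigma>"
proof -
  have "\<exists>\<Sigma> \<Gamma>'. \<Gamma> = image_mset Box \<Sigma> + \<Gamma>' \<and> (\<forall>\<psi>. Box \<psi> \<in># \<Gamma> \<longleftrightarrow> \<psi> \<in># \<Sigma>)"
  proof (induction \<Gamma>)
    case (add \<phi> \<Gamma>)
    then obtain \<Sigma> \<Gamma>' where *: "\<Gamma> = image_mset Box \<Sigma> + \<Gamma>'" "\<forall>\<psi>. Box \<psi> \<in># \<Gamma> \<longleftrightarrow> \<psi> \<in># \<Sigma>"
      by blast
    show ?case
    proof (cases "\<exists>\<psi>. \<phi> = Box \<psi>")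
      case True
      then obtain \<psi> where "\<phi> = Box \<psi>" ..
      with * show ?thesis
        by (intro exI[of _ "add_mset \<psi> \<Sigma>"] exI[of _ \<Gamma>']) auto
    next
      case False
      with * show ?thesis
        by (intro exI[of _ \<Sigma>] exI[of _ "add_mset \<phi> \<Gamma>'"]) auto
    qed
  qed simp
  with that show ?thesis by blast
qed

text \<open>The new root makes exactly the variables on the left true. By \<open>sat_Box_boxdot\<close> the boxes on
  the left hold at the root because each child satisfies \<open>boxdot_mset n \<Sigma>\<close>, and each
  \<open>Box \<phi>\<close> on the right fails because of the child chosen for \<open>\<phi>\<close>.\<close>

lemma glue_countermodels:
  assumes n: "n \<ge> 1"
    and left: "\<And>\<phi>. \<phi> \<in># \<Gamma> \<Longrightarrow> (\<exists>p. \<phi> = Var p) \<or> (\<exists>\<psi>. \<phi> = Box \<psi>)"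
    and right: "\<And>\<phi>. \<phi> \<in># \<Delta> \<Longrightarrow> (\<exists>p. \<phi> = Var p) \<or> (\<exists>\<psi>. \<phi> = Box \<psi>)"
    and disjoint: "\<And>p. Var p \<in># \<Gamma> \<Longrightarrow> Var p \<notin># \<Delta>"
    and boxes: "\<And>\<psi>. Box \<psi> \<in># \<Gamma> \<Longrightarrow> \<psi> \<in># \<Sigma>"
    and refuted: "\<And>\<phi>. Box \<phi> \<in># \<Delta> \<Longrightarrow> \<exists>M. refutes n M (boxdot_mset n \<Sigma>, {#\<phi>#})"
  shows "\<exists>M. refutes n M (\<Gamma>, \<Delta>)"
proof -
  define D where "D = {\<phi>. Box \<phi> \<in># \<Delta>}"
  have "D = Box -` set_mset \<Delta>"
    by (auto simp: D_def)
  then have "finite D"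
    by (auto intro: finite_vimageI simp: inj_def)
  obtain m where m: "\<And>\<phi>. \<phi> \<in> D \<Longrightarrow> refutes n (m \<phi>) (boxdot_mset n \<Sigma>, {#\<phi>#})"
    using refuted unfolding D_def by (metis mem_Collect_eq)
  obtain Ms where Ms: "set Ms = m ` D"
    using finite_list[of "m ` D"] \<open>finite D\<close> by auto
  let ?M = "Point {p. Var p \<in># \<Gamma>} Ms"
  have "sat n ?M \<phi>" if "\<phi> \<in># \<Gamma>" for \<phi>
    using left[OF that]
  proof (elim disjE exE)
    fix \<psi> assume "\<phi> = Box \<psi>"
    with that have "\<psi> \<in># \<Sigma>"
      using boxes by simp
    then show ?thesis
      using m Ms unfolding \<open>\<phi> = Box \<psi>\<close> sat_Box_boxdot[OF n]
      by (auto simp: refutes_def boxdot_mset_def box_pow_mset_def)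
  qed (use that in simp)
  moreover have "\<not> sat n ?M \<phi>" if "\<phi> \<in># \<Delta>" for \<phi>
    using right[OF that]
  proof (elim disjE exE)
    fix \<psi> assume "\<phi> = Box \<psi>"
    with that have "\<psi> \<in> D"
      by (simp add: D_def)
    then have "m \<psi> \<in> set Ms" "\<not> sat n (m \<psi>) \<psi>"
      using m Ms by (auto simp: refutes_def)
    then show ?thesis
      unfolding \<open>\<phi> = Box \<psi>\<close> sat_Box_boxdot[OF n] by auto
  qed (use that disjoint in auto)
  ultimately show ?thesis
    by (auto simp: refutes_def)
qed

text \<open>In the modal case \<open>\<Sigma>\<close> collects all boxed formulas on the left, rather than just some:
  \<open>locked_modal\<close> needs that none of them is lost in the premise.\<close>

lemma valid_step:
  assumes n: "n \<ge> 1" and valid: "valid n S"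
  obtains
    (propositional_rule) r Ss where "r \<in> propositional" "rule_inst n r Ss S"
      "\<forall>S'\<in>set Ss. valid n S'"
  | (modal) \<Sigma> \<Gamma> \<phi> \<Delta> where "S = (image_mset Box \<Sigma> + \<Gamma>, add_mset (Box \<phi>) \<Delta>)"
      "\<And>\<psi>. Box \<psi> \<in># fst S \<Longrightarrow> \<psi> \<in># \<Sigma>" "valid n (boxdot_mset n \<Sigma>, {#\<phi>#})"
proof -
  obtain \<Gamma> \<Delta> where S: "S = (\<Gamma>, \<Delta>)"
    by (cases S)
  consider (BotL) "Bot \<in># \<Gamma>" | (BotR) "Bot \<in># \<Delta>"
    | (ImpL) \<phi> \<psi> where "Imp \<phi> \<psi> \<in># \<Gamma>" | (ImpR) \<phi> \<psi> where "Imp \<phi> \<psi> \<in># \<Delta>"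
    | (Ax) p where "Var p \<in># \<Gamma>" "Var p \<in># \<Delta>"
    | (saturated) "\<And>\<phi>. \<phi> \<in># \<Gamma> \<Longrightarrow> (\<exists>p. \<phi> = Var p) \<or> (\<exists>\<psi>. \<phi> = Box \<psi>)"
        "\<And>\<phi>. \<phi> \<in># \<Delta> \<Longrightarrow> (\<exists>p. \<phi> = Var p) \<or> (\<exists>\<psi>. \<phi> = Box \<psi>)"
        "\<And>p. Var p \<in># \<Gamma> \<Longrightarrow> Var p \<notin># \<Delta>"
    by (metis fm.exhaust)
  then show ?thesis
  proof cases
    case BotL
    then obtain \<Gamma>' where "\<Gamma> = add_mset Bot \<Gamma>'"
      by (auto dest: multi_member_split)
    then show ?thesis
      using S by (intro propositional_rule[of BotL "[]"]) (auto simp: propositional_def intro: rule_inst.intros)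
  next
    case BotR
    then obtain \<Delta>' where "\<Delta> = add_mset Bot \<Delta>'"
      by (auto dest: multi_member_split)
    then show ?thesis
      using S valid by (intro propositional_rule[of BotR "[(\<Gamma>, \<Delta>')]"])
        (auto simp: propositional_def valid_def refutes_def intro: rule_inst.intros)
  next
    case ImpL
    then obtain \<Gamma>' where "\<Gamma> = add_mset (Imp \<phi> \<psi>) \<Gamma>'"
      by (auto dest: multi_member_split)
    then show ?thesis
      using S valid by (intro propositional_rule[of ImpL "[(\<Gamma>', add_mset \<phi> \<Delta>), (add_mset \<psi> \<Gamma>', \<Delta>)]"])
        (auto simp: propositional_def valid_def refutes_def intro: rule_inst.intros)
  next
    case ImpR
    then obtain \<Delta>' where "\<Delta> = add_mset (Imp \<phi> \<psi>) \<Delta>'"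
      by (auto dest: multi_member_split)
    then show ?thesis
      using S valid by (intro propositional_rule[of ImpR "[(add_mset \<phi> \<Gamma>, add_mset \<psi> \<Delta>')]"])
        (auto simp: propositional_def valid_def refutes_def intro: rule_inst.intros)
  next
    case Ax
    then obtain \<Gamma>' \<Delta>' where "\<Gamma> = add_mset (Var p) \<Gamma>'" "\<Delta> = add_mset (Var p) \<Delta>'"
      by (auto dest!: multi_member_split)
    then show ?thesis
      using S by (intro propositional_rule[of Ax "[]"]) (auto simp: propositional_def intro: rule_inst.intros)
  next
    case saturated
    obtain \<Sigma> \<Gamma>' where \<Sigma>: "\<Gamma> = image_mset Box \<Sigma> + \<Gamma>'" "\<And>\<psi>. Box \<psi> \<in># \<Gamma> \<longleftrightarrow> \<psi> \<in># \<Sigma>"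
      using Box_part[of \<Gamma>] by blast
    have "\<exists>\<phi>. Box \<phi> \<in># \<Delta> \<and> valid n (boxdot_mset n \<Sigma>, {#\<phi>#})"
    proof (rule ccontr)
      assume none: "\<not> ?thesis"
      have "\<exists>M. refutes n M (\<Gamma>, \<Delta>)"
      proof (rule glue_countermodels[OF n])
        show "\<psi> \<in># \<Sigma>" if "Box \<psi> \<in># \<Gamma>" for \<psi>
          using that \<Sigma>(2) by blast
        show "\<exists>M. refutes n M (boxdot_mset n \<Sigma>, {#\<phi>#})" if "Box \<phi> \<in># \<Delta>" for \<phi>
          using that none by (auto simp: valid_def)
      qed (fact saturated)+
      with valid show False
        by (simp add: S valid_def)
    qed
    then obtain \<phi> where "Box \<phi> \<in># \<Delta>" "valid n (boxdot_mset n \<Sigma>, {#\<phi>#})"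
      by blast
    moreover from this obtain \<Delta>' where "\<Delta> = add_mset (Box \<phi>) \<Delta>'"
      by (auto dest: multi_member_split)
    ultimately show ?thesis
      using S \<Sigma> by (intro modal[of \<Sigma> \<Gamma>' \<phi> \<Delta>']) auto
  qed
qed

section \<open>Completeness of the non-wellfounded calculus\<close>

primcorec unfold_proof ::
    "(sequent \<Rightarrow> rule_name) \<Rightarrow> (sequent \<Rightarrow> sequent list) \<Rightarrow> sequent \<Rightarrow> ptree" where
  "unfold_proof r p S = Node S (r S) (map (unfold_proof r p) (p S))"

lemma locally_correct_unfold_proof:
  assumes step: "\<And>S. P S \<Longrightarrow> r S \<in> R \<and> rule_inst n (r S) (p S) S \<and> (\<forall>S'\<in>set (p S). P S')"
  shows "P S \<Longrightarrow> locally_correct n R (unfold_proof r p S)"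
proof (coinduction arbitrary: S)
  case locally_correct
  have "map concl (map (unfold_proof r p) (p S)) = p S"
    by (simp add: comp_def)
  with step[OF locally_correct] show ?case
    by (subst unfold_proof.code) auto
qed

text \<open>A branch that eventually avoids \<open>BoxK4\<close> would decrease the weight at each further step.\<close>

lemma progressing_cut_free:
  assumes "locally_correct n GwGL_inf t"
  shows "progressing t"
  unfolding progressing_def
proof (intro allI impI)
  fix b assume b: "infinite_branch t b"
  have correct: "locally_correct n GwGL_inf (b i)" for i
    using b assms by (induction i) (auto simp: infinite_branch_def intro: locally_correct_subtree)
  show "\<exists>\<^sub>\<infinity>i. last_rule (b i) = BoxK4"
  proof (rule ccontr)
    assume "\<not> (\<exists>\<^sub>\<infinity>i. last_rule (b i) = BoxK4)"
    then obtain N where N: "\<And>i. i \<ge> N \<Longrightarrow> last_rule (b i) \<noteq> BoxK4"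
      by (auto simp: INFM_nat_le)
    define w where "w i = seq_weight (concl (b (N + i)))" for i
    have "w (Suc i) < w i" for i
    proof -
      have "last_rule (b (N + i)) \<in> propositional"
        using locally_correct_rule[OF correct] N[of "N + i"]
        by (fastforce simp: GwGL_inf_def propositional_def)
      moreover have "concl (b (N + Suc i)) \<in> set (map concl (subtrees (b (N + i))))"
        using b by (auto simp: infinite_branch_def)
      ultimately show ?thesis
        unfolding w_def using propositional_weight locally_correct_rule[OF correct] by blast
    qed
    then show False
      using no_infinite_descent[of w] by (auto simp: less_imp_le)
  qed
qed

lemma complete_inf:
  assumes n: "n \<ge> 1" and "valid n S"
  shows "provable_inf n GwGL_inf S"
proof -
  have "\<exists>r Ss. r \<in> GwGL_inf \<and> rule_inst n r Ss S \<and> (\<forall>S'\<in>set Ss. valid n S')"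
    if "valid n S" for S
    using n that
  proof (cases rule: valid_step)
    case (propositional_rule r Ss)
    then show ?thesis
      by (auto simp: GwGL_inf_def propositional_def)
  next
    case (modal \<Sigma> \<Gamma> \<phi> \<Delta>)
    then show ?thesis
      by (intro exI[of _ BoxK4] exI[of _ "[(boxdot_mset n \<Sigma>, {#\<phi>#})]"])
        (auto simp: GwGL_inf_def intro: rule_inst.intros)
  qed
  then obtain r p where
    "\<And>S. valid n S \<Longrightarrow> r S \<in> GwGL_inf \<and> rule_inst n (r S) (p S) S \<and> (\<forall>S'\<in>set (p S). valid n S')"
    by metis
  from locally_correct_unfold_proof[of "valid n", OF this assms(2)]
  show ?thesis
    unfolding provable_inf_def using progressing_cut_free unfold_proof.sel(1) by blast
qed

section \<open>Completeness of the wellfounded calculus\<close>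

lemma provable_rule:
  assumes "r \<in> R" "rule_inst n r Ss S" "\<forall>S'\<in>set Ss. provable n R S'"
  shows "provable n R S"
proof -
  obtain f where f: "\<And>S'. S' \<in> set Ss \<Longrightarrow>
      concl (f S') = S' \<and> locally_correct n R (f S') \<and> finite_tree (f S')"
    using assms(3) unfolding provable_def by metis
  then have "map concl (map f Ss) = Ss"
    by (simp add: map_idI)
  with f assms show ?thesis
    unfolding provable_def
    by (intro exI[of _ "Node S r (map f Ss)"])
      (auto intro!: locally_correct.intros finite_tree.intros)
qed

lemma provable_identity: "provable n GwGL (add_mset \<phi> \<Gamma>, add_mset \<phi> \<Delta>)"
proof (induction \<phi> arbitrary: \<Gamma> \<Delta>)
  case (Var p)
  show ?case
    by (rule provable_rule[OF _ inst_Ax]) (auto simp: GwGL_def)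
next
  case Bot
  show ?case
    by (rule provable_rule[OF _ inst_BotL]) (auto simp: GwGL_def)
next
  case (Imp \<phi> \<psi>)
  have "provable n GwGL (add_mset \<phi> \<Gamma>, add_mset \<phi> (add_mset \<psi> \<Delta>))"
    "provable n GwGL (add_mset \<psi> (add_mset \<phi> \<Gamma>), add_mset \<psi> \<Delta>)"
    using Imp by blast+
  then have "provable n GwGL (add_mset (Imp \<phi> \<psi>) (add_mset \<phi> \<Gamma>), add_mset \<psi> \<Delta>)"
    by (intro provable_rule[OF _ inst_ImpL]) (auto simp: GwGL_def)
  then show ?case
    by (intro provable_rule[OF _ inst_ImpR]) (auto simp: GwGL_def add_mset_commute)
next
  case (Box \<phi>)
  have "provable n GwGL (add_mset (box_pow n \<phi>) (boxdot_mset n {#\<phi>#}), {#\<phi>#})"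
    using Box[of "{#box_pow n \<phi>, box_pow n \<phi>#}" "{#}"]
    by (simp add: boxdot_mset_def box_pow_mset_def add_mset_commute)
  then show ?case
    using provable_rule[OF _ inst_BoxGL[of n \<phi> "{#\<phi>#}" \<Gamma> \<Delta>], of GwGL] by (simp add: GwGL_def)
qed

text \<open>A bound on the formulas \<open>\<psi>\<close> for which \<open>Box \<psi>\<close> can be principal in a backward search
  from a sequent with the given formula on the right (flag \<open>True\<close>) or on the left. For
  \<open>Box \<phi>\<close> on the right, \<open>\<phi>\<close> is followed at both polarities, as \<open>BoxGL\<close> places \<open>\<phi>\<close> on the
  right and \<open>box_pow n \<phi>\<close> on the left. A box on the left contributes no body of its own, which is
  why the growing powers \<open>box_pow m \<phi>\<close> do no harm.\<close>

primrec bodies :: "bool \<Rightarrow> fm \<Rightarrow> fm set" where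
  "bodies s (Var p) = {}"
| "bodies s Bot = {}"
| "bodies s (Imp \<phi> \<psi>) = bodies (\<not> s) \<phi> \<union> bodies s \<psi>"
| "bodies s (Box \<phi>) =
    (if s then insert \<phi> (bodies True \<phi> \<union> bodies False \<phi>) else bodies False \<phi>)"

definition seq_bodies :: "sequent \<Rightarrow> fm set" where
  "seq_bodies S = (\<Union>\<phi>\<in>set_mset (fst S). bodies False \<phi>) \<union> (\<Union>\<phi>\<in>set_mset (snd S). bodies True \<phi>)"

text \<open>If \<open>box_pow (Suc i) \<phi>\<close> is on the left, then after \<open>i\<close> modal steps \<open>Box \<phi>\<close> is on the
  left, and a sequent with \<open>Box \<phi>\<close> on the right as well is an instance of identity. The pair
  \<open>(\<phi>, i)\<close> thus rules out that \<open>\<phi>\<close> is used again \<open>i\<close> steps (modulo \<open>n\<close>) ahead.\<close>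

definition locked :: "nat \<Rightarrow> fm set \<Rightarrow> sequent \<Rightarrow> (fm \<times> nat) set" where
  "locked n C S = {(\<phi>, i). \<phi> \<in> C \<and> i < n \<and> box_pow (Suc i) \<phi> \<in># fst S}"

lemma finite_bodies: "finite (bodies s \<phi>)"
  by (induction \<phi> arbitrary: s) auto

lemma finite_seq_bodies: "finite (seq_bodies S)"
  by (auto simp: seq_bodies_def finite_bodies)

lemma bodies_box_pow: "bodies False (box_pow m \<phi>) = bodies False \<phi>"
  by (induction m) auto

lemma locked_subset: "locked n C S \<subseteq> C \<times> {..<n}"
  by (auto simp: locked_def)

lemma seq_bodies_propositional:
  "rule_inst n r Ss S \<Longrightarrow> r \<in> propositional \<Longrightarrow> S' \<in> set Ss \<Longrightarrow> seq_bodies S' \<subseteq> seq_bodies S"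
  by (erule rule_inst.cases) (auto simp: propositional_def seq_bodies_def)

lemma locked_propositional:
  "rule_inst n r Ss S \<Longrightarrow> r \<in> propositional \<Longrightarrow> S' \<in> set Ss \<Longrightarrow> locked n C S \<subseteq> locked n C S'"
  by (erule rule_inst.cases) (auto simp: propositional_def locked_def)

lemma seq_bodies_modal:
  "seq_bodies (add_mset (box_pow n \<phi>) (boxdot_mset n \<Sigma>), {#\<phi>#})
    \<subseteq> seq_bodies (image_mset Box \<Sigma> + \<Gamma>, add_mset (Box \<phi>) \<Delta>)"
  by (auto simp: seq_bodies_def boxdot_mset_def box_pow_mset_def bodies_box_pow)

text \<open>A modal step turns the lock \<open>(\<psi>, i)\<close> into \<open>(\<psi>, i - 1)\<close>; at \<open>i = 0\<close> the formula \<open>Box \<psi>\<close>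
  itself is consumed, and the \<open>box_pow n \<psi>\<close> in the premise renews the lock as \<open>(\<psi>, n - 1)\<close>. So
  locks are permuted cyclically and none is lost. The diagonal formula \<open>box_pow n \<phi>\<close> supplies
  the lock \<open>(\<phi>, n - 1)\<close>, which is not the image of an old one since that would be
  \<open>(\<phi>, 0)\<close>, that is, \<open>Box \<phi>\<close> on the left.\<close>

lemma locked_modal:
  assumes n: "n \<ge> 1" and C: "finite C" "\<phi> \<in> C"
    and boxes: "\<And>\<psi>. Box \<psi> \<in># fst S \<Longrightarrow> \<psi> \<in># \<Sigma>" and new: "Box \<phi> \<notin># fst S"
  shows "card (locked n C S) < card (locked n C (add_mset (box_pow n \<phi>) (boxdot_mset n \<Sigma>), {#\<phi>#}))"
    (is "_ < card ?L'")
proof -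
  let ?shift = "\<lambda>(\<psi> :: fm, i). (\<psi>, if i = 0 then n - 1 else i - 1)"
  have fin: "finite (locked n C S')" for S'
    using finite_subset[OF locked_subset] C by blast
  have "inj_on ?shift (locked n C S)"
    by (auto simp: inj_on_def locked_def split: if_splits)
  then have "card (locked n C S) = card (?shift ` locked n C S)"
    by (simp add: card_image)
  also have "\<dots> < card ?L'"
  proof (rule psubset_card_mono[OF fin], rule psubsetI)
    have "(\<psi>, if i = 0 then n - 1 else i - 1) \<in> ?L'" if "(\<psi>, i) \<in> locked n C S" for \<psi> i
    proof -
      from that have *: "\<psi> \<in> C" "i < n" "Box (box_pow i \<psi>) \<in># fst S"
        by (auto simp: locked_def)
      then have "box_pow i \<psi> \<in># \<Sigma>"
        using boxes by blast
      then show ?thesis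
        using * n by (cases i; cases n)
          (auto simp: locked_def boxdot_mset_def box_pow_mset_def simp flip: funpow.simps(2))
    qed
    then show "?shift ` locked n C S \<subseteq> ?L'"
      by auto
    have "(\<phi>, n - 1) \<in> ?L'"
      using n C by (cases n) (auto simp: locked_def)
    moreover have "(\<phi>, n - 1) \<notin> ?shift ` locked n C S"
      using new by (auto simp: locked_def split: if_splits)
    ultimately show "?shift ` locked n C S \<noteq> ?L'"
      by blast
  qed
  finally show ?thesis .
qed

text \<open>Backward search along \<open>valid_step\<close> terminates for the lexicographic order on the number of
  pairs not yet locked and the weight: modal steps decrease the former, propositional steps keep all
  locks and decrease the latter.\<close>

lemma complete_finite:
  assumes n: "n \<ge> 1" and C: "finite C"
  shows "valid n S \<Longrightarrow> seq_bodies S \<subseteq> C \<Longrightarrow> provable n GwGL S"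
proof (induction S rule: wf_induct_rule[OF wf_measures
    [of "[\<lambda>S. card (C \<times> {..<n}) - card (locked n C S), seq_weight]"]])
  case (1 S)
  have "finite (C \<times> {..<n})"
    using C by blast
  then have fin: "finite (locked n C S')" and le: "card (locked n C S') \<le> card (C \<times> {..<n})" for S'
    using card_mono[OF _ locked_subset] finite_subset[OF locked_subset] by blast+
  from n 1(2) show ?case
  proof (cases rule: valid_step)
    case (propositional_rule r Ss)
    have "provable n GwGL S'" if S': "S' \<in> set Ss" for S'
    proof (rule 1(1))
      show "(S', S) \<in> measures [\<lambda>S. card (C \<times> {..<n}) - card (locked n C S), seq_weight]"
        using card_mono[OF fin locked_propositional[OF propositional_rule(2,1) S', of C]]
          propositional_weight[OF propositional_rule(2,1) S'] by auto
      show "valid n S'"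
        using propositional_rule S' by blast
      show "seq_bodies S' \<subseteq> C"
        using seq_bodies_propositional[OF propositional_rule(2,1) S'] 1(3) by blast
    qed
    moreover have "r \<in> GwGL"
      using propositional_rule by (auto simp: propositional_def GwGL_def)
    ultimately show ?thesis
      using provable_rule propositional_rule by blast
  next
    case (modal \<Sigma> \<Gamma> \<phi> \<Delta>)
    let ?S' = "(add_mset (box_pow n \<phi>) (boxdot_mset n \<Sigma>), {#\<phi>#})"
    show ?thesis
    proof (cases "Box \<phi> \<in># fst S")
      case True
      then obtain \<Gamma>' where "fst S = add_mset (Box \<phi>) \<Gamma>'"
        by (auto dest: multi_member_split)
      then show ?thesis
        using provable_identity[of n "Box \<phi>" \<Gamma>' \<Delta>] modal(1) by simp
    next
      case False
      have "\<phi> \<in> C"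
        using 1(3) modal(1) by (auto simp: seq_bodies_def)
      have "provable n GwGL ?S'"
      proof (rule 1(1))
        show "(?S', S) \<in> measures [\<lambda>S. card (C \<times> {..<n}) - card (locked n C S), seq_weight]"
          using diff_less_mono2[OF locked_modal[OF n C \<open>\<phi> \<in> C\<close> modal(2) False]
              less_le_trans[OF locked_modal[OF n C \<open>\<phi> \<in> C\<close> modal(2) False] le]]
          by simp
        show "valid n ?S'"
          using modal(3) by (auto simp: valid_def refutes_def)
        show "seq_bodies ?S' \<subseteq> C"
          using seq_bodies_modal[of n \<phi> \<Sigma> \<Gamma> \<Delta>] 1(3) modal(1) by simp
      qed
      then show ?thesis
        using provable_rule[OF _ inst_BoxGL, of GwGL] modal(1) by (simp add: GwGL_def)
    qed
  qed
qed

theorem mainTheorem2: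
  fixes n :: nat
  assumes "n \<ge> 1"
  shows "(\<forall>S. provable_inf n (insert Cut GwGL_inf) S \<longrightarrow> provable_inf n GwGL_inf S) \<and>
         (\<forall>S. provable n (insert Cut GwGL) S \<longrightarrow> provable n GwGL S)"
proof (intro conjI allI impI)
  fix S assume "provable_inf n (insert Cut GwGL_inf) S"
  then have "valid n S"
    using sound_progressing[OF assms] by (auto simp: provable_inf_def)
  then show "provable_inf n GwGL_inf S"
    by (rule complete_inf[OF assms])
next
  fix S assume "provable n (insert Cut GwGL) S"
  then have "valid n S"
    using sound_finite[OF assms] by (auto simp: provable_def)
  then show "provable n GwGL S"
    using complete_finite[OF assms finite_seq_bodies] by blast
qed

end
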